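(* Let $G$ and $G'$ be finite groups and let $C=(\mathcal X,\mathcal K)$ and $C'=(\mathcal X',\mathcal K')$ be supercharacter theories of $G$ and $G'$ respectively. Then $G$ is $C$-quasi-monomial and $G'$ is $C'$-quasi-monomial if and only if $G\times G'$ is $C\times C'$-quasi-monomial.
   Context: $\operatorname{Irr}(G)$ is the set of complex irreducible characters; $\lambda^G$ denotes induction. A supercharacter theory of $G$ is a pair $C=(\mathcal X,\mathcal K)$ with $\mathcal X$ a partition of $\operatorname{Irr}(G)$ and $\mathcal K$ a partition of $G$ such that $\{1\}\in\mathcal K$, $|\mathcal X|=|\mathcal K|$, and for each $X\in\mathcal X$ the character $\sigma_X=\sum_{\psi\in X}\psi(1)\psi$ is constant on each $K\in\mathcal K$. Given $C$ with $\mathcal X=\{X_1,\ldots,X_m\}$, $G$ is $C$-quasi-monomial if for every $k$ there exist subgroups $H_1,\ldots,H_t\leqslant G$ and linear characters $\lambda_i$ of $H_i$ with $\lambda_1^G+\cdots+\lambda_t^G=d\sigma_{X_k}$ for some positive integer $d$. The product theory $C\times C'=(\mathcal X\times\mathcal X',\mathcal K\times\mathcal K')$ of $G\times G'$ has parts $X\times X'=\{\chi\times\chi':\chi\in X,\chi'\in X'\}$ for $X\in\mathcal X$, $X'\in\mathcal X'$, and superclasses $K\times K'$ for $K\in\mathcal K$, $K'\in\mathcal K'$; it is a supercharacter theory of $G\times G'$. *)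

theory Defs
  imports
    "HOL-Algebra.Group"
    "HOL-Library.Disjoint_Sets"
    "Jordan_Normal_Form.VS_Connect"
begin

abbreviation GL :: "nat \<Rightarrow> complex mat monoid" where
  "GL n \<equiv> units_of (ring_mat TYPE(complex) n ())"

definition representation :: "('a, 'm) monoid_scheme \<Rightarrow> nat \<Rightarrow> ('a \<Rightarrow> complex mat) \<Rightarrow> bool" where
  "representation G n \<rho> \<longleftrightarrow> \<rho> \<in> hom G (GL n)"

definition irreducible_representation ::
    "('a, 'm) monoid_scheme \<Rightarrow> nat \<Rightarrow> ('a \<Rightarrow> complex mat) \<Rightarrow> bool" where
  "irreducible_representation G n \<rho> \<longleftrightarrow>
     representation G n \<rho> \<and> n > 0 \<and>
     (\<forall>W. subspace class_ring W (module_vec TYPE(complex) n) \<and>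
          (\<forall>g\<in>carrier G. \<forall>w\<in>W. \<rho> g *\<^sub>v w \<in> W)
          \<longrightarrow> W = {0\<^sub>v n} \<or> W = carrier_vec n)"

definition trace :: "complex mat \<Rightarrow> complex" where
  "trace A = (\<Sum>i<dim_row A. A $$ (i, i))"

(* Characters are total functions on the ambient type, extended by 0 off the carrier,
   so that equal characters of G are equal HOL functions. *)
definition character :: "('a, 'm) monoid_scheme \<Rightarrow> ('a \<Rightarrow> complex mat) \<Rightarrow> 'a \<Rightarrow> complex" where
  "character G \<rho> g = (if g \<in> carrier G then trace (\<rho> g) else 0)"

definition Irr :: "('a, 'm) monoid_scheme \<Rightarrow> ('a \<Rightarrow> complex) set" where
  "Irr G = {character G \<rho> | \<rho>. \<exists>n. irreducible_representation G n \<rho>}"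

definition linear_character :: "('a, 'm) monoid_scheme \<Rightarrow> ('a \<Rightarrow> complex) \<Rightarrow> bool" where
  "linear_character G \<chi> \<longleftrightarrow> (\<exists>\<rho>. representation G 1 \<rho> \<and> \<chi> = character G \<rho>)"

definition induced :: "('a, 'm) monoid_scheme \<Rightarrow> 'a set \<Rightarrow> ('a \<Rightarrow> complex) \<Rightarrow> 'a \<Rightarrow> complex" where
  "induced G H \<phi> g =
     (\<Sum>x \<in> {x \<in> carrier G. inv\<^bsub>G\<^esub> x \<otimes>\<^bsub>G\<^esub> g \<otimes>\<^bsub>G\<^esub> x \<in> H}. \<phi> (inv\<^bsub>G\<^esub> x \<otimes>\<^bsub>G\<^esub> g \<otimes>\<^bsub>G\<^esub> x))
       / of_nat (card H)"

definition sigma :: "('a, 'm) monoid_scheme \<Rightarrow> ('a \<Rightarrow> complex) set \<Rightarrow> 'a \<Rightarrow> complex" where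
  "sigma G X g = (\<Sum>\<psi>\<in>X. \<psi> \<one>\<^bsub>G\<^esub> * \<psi> g)"

type_synonym 'a char_theory = "('a \<Rightarrow> complex) set set \<times> 'a set set"

definition supercharacter_theory :: "('a, 'm) monoid_scheme \<Rightarrow> 'a char_theory \<Rightarrow> bool" where
  "supercharacter_theory G = (\<lambda>(\<X>, \<K>).
     partition_on (Irr G) \<X> \<and> partition_on (carrier G) \<K> \<and>
     {\<one>\<^bsub>G\<^esub>} \<in> \<K> \<and> card \<X> = card \<K> \<and>
     (\<forall>X\<in>\<X>. \<forall>K\<in>\<K>. \<forall>g\<in>K. \<forall>h\<in>K. sigma G X g = sigma G X h))"

definition quasi_monomial :: "('a, 'm) monoid_scheme \<Rightarrow> 'a char_theory \<Rightarrow> bool" where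
  "quasi_monomial G = (\<lambda>(\<X>, \<K>).
     \<forall>X\<in>\<X>. \<exists>(t::nat) H l.
       (\<forall>i\<in>{1..t}. subgroup (H i) G \<and> linear_character (G\<lparr>carrier := H i\<rparr>) (l i)) \<and>
       (\<exists>d::nat. d > 0 \<and>
          (\<forall>g\<in>carrier G. (\<Sum>i=1..t. induced G (H i) (l i) g) = of_nat d * sigma G X g)))"

definition char_prod :: "('a \<Rightarrow> complex) \<Rightarrow> ('b \<Rightarrow> complex) \<Rightarrow> 'a \<times> 'b \<Rightarrow> complex" where
  "char_prod \<chi> \<chi>' = (\<lambda>(g, g'). \<chi> g * \<chi>' g')"

definition prod_theory :: "'a char_theory \<Rightarrow> 'b char_theory \<Rightarrow> ('a \<times> 'b) char_theory" where
  "prod_theory = (\<lambda>(\<X>, \<K>) (\<X>', \<K>').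
     ({{char_prod \<chi> \<chi>' | \<chi> \<chi>'. \<chi> \<in> X \<and> \<chi>' \<in> X'} | X X'. X \<in> \<X> \<and> X' \<in> \<X>'},
      {K \<times> K' | K K'. K \<in> \<K> \<and> K' \<in> \<K>'}))"

end

theory Submission
  imports Defs "Jordan_Normal_Form.Spectral_Radius"
begin

text \<open>
  If \<open>\<Sum>\<^sub>i \<lambda>\<^sub>i\<^sup>G = d \<sigma>\<^sub>X\<close> and \<open>\<Sum>\<^sub>j \<mu>\<^sub>j\<^bsup>G'\<^esup> = d' \<sigma>\<^bsub>X'\<^esub>\<close>, then inducing the products \<open>\<lambda>\<^sub>i \<times> \<mu>\<^sub>j\<close> gives
  \<open>d d' \<sigma>\<^sub>X \<times> \<sigma>\<^bsub>X'\<^esub>\<close>, which is \<open>d d'\<close> times the \<open>\<sigma>\<close> of the part \<open>X \<times> X'\<close> because distinct pairs of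
  irreducible characters have distinct products. Conversely, restrict an identity
  \<open>\<Sum>\<^sub>i \<lambda>\<^sub>i\<^bsup>G \<times> G'\<^esup> = d \<sigma>\<^sub>X \<times> \<sigma>\<^bsub>X'\<^esub>\<close> to \<open>G \<times> 1\<close>. By Mackey's formula the left-hand side becomes a rational
  combination of characters induced from linear characters of subgroups of \<open>G\<close>, and
  multiplying by \<open>|G \<times> G'|\<close> clears the denominators; the right-hand side becomes
  \<open>d \<sigma>\<^bsub>X'\<^esub>(1) \<sigma>\<^sub>X\<close>. Here \<open>\<sigma>\<^bsub>X'\<^esub>(1)\<close> is a positive integer since \<open>Irr(G')\<close> is finite, which, like the
  injectivity of the product of characters, follows from the orthogonality relations.
\<close>

section \<open>Orthogonality of irreducible characters\<close>

lemma index_mat_mult_sum: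
  assumes "A \<in> carrier_mat n p" "B \<in> carrier_mat p m" "i < n" "j < m"
  shows "(A * B) $$ (i, j) = (\<Sum>k<p. A $$ (i, k) * B $$ (k, j))"
  using assms by (auto simp: scalar_prod_def atLeast0LessThan)

lemma trace_mult_comm:
  assumes "A \<in> carrier_mat n m" "B \<in> carrier_mat m n"
  shows "trace (A * B) = trace (B * A)"
proof -
  have "trace (A * B) = (\<Sum>i<n. \<Sum>k<m. A $$ (i, k) * B $$ (k, i))"
    using assms by (auto simp: trace_def index_mat_mult_sum simp del: index_mult_mat(1) intro!: sum.cong)
  also have "\<dots> = (\<Sum>k<m. \<Sum>i<n. B $$ (k, i) * A $$ (i, k))"
    by (subst sum.swap) (simp add: mult.commute)
  also have "\<dots> = trace (B * A)"
    using assms by (auto simp: trace_def index_mat_mult_sum simp del: index_mult_mat(1) intro!: sum.cong)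
  finally show ?thesis .
qed

section \<open>Matrix representations and Schur's lemma\<close>

lemma subspace_module_vecI:
  assumes "W \<subseteq> carrier_vec n" "0\<^sub>v n \<in> W"
    and "\<And>v w. v \<in> W \<Longrightarrow> w \<in> W \<Longrightarrow> v + w \<in> W"
    and "\<And>c v. v \<in> W \<Longrightarrow> c \<cdot>\<^sub>v v \<in> W"
  shows "VectorSpace.subspace class_ring W (module_vec TYPE(complex) n)"
  unfolding VectorSpace.subspace_def submodule_def
  using assms vec_vs vec_module by (auto simp: module_vec_simps)

lemma Units_ring_mat_iff:
  "A \<in> Units (ring_mat TYPE(complex) n ()) \<longleftrightarrow>
     A \<in> carrier_mat n n \<and> (\<exists>B\<in>carrier_mat n n. B * A = 1\<^sub>m n \<and> A * B = 1\<^sub>m n)"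
  by (simp add: Units_def ring_mat_simps)

lemma representationD:
  assumes "representation G n \<rho>"
  shows "g \<in> carrier G \<Longrightarrow> \<rho> g \<in> carrier_mat n n"
    and "g \<in> carrier G \<Longrightarrow> h \<in> carrier G \<Longrightarrow> \<rho> (g \<otimes>\<^bsub>G\<^esub> h) = \<rho> g * \<rho> h"
  using assms
  by (auto simp: representation_def hom_def units_of_def Units_ring_mat_iff Pi_iff ring_mat_simps)

lemma representation_one:
  assumes "group G" "representation G n \<rho>"
  shows "\<rho> \<one>\<^bsub>G\<^esub> = 1\<^sub>m n"
proof -
  interpret ring "ring_mat TYPE(complex) n ()" by (rule ring_mat)
  have "group (GL n)" by (rule units_group)
  then show ?thesis
    using hom_one[of \<rho> G "GL n"] assms by (simp add: representation_def units_of_def ring_mat_simps)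
qed

text \<open>Schur's lemma, first half. The kernel \<open>K\<close> of \<open>A\<close> is invariant
  under \<open>\<tau>\<close> and the range \<open>R\<close> under \<open>\<rho>\<close>, so
  irreducibility and \<open>A \<noteq> 0\<close> leave only trivial kernel and full range. Equality
  of \<open>n\<close> and \<open>m\<close> is not assumed, so both products with the inverse are
  established separately.\<close>

lemma intertwiner_invertible:
  assumes \<rho>: "irreducible_representation G n \<rho>" and \<tau>: "irreducible_representation G m \<tau>"
    and A: "A \<in> carrier_mat n m"
    and comm: "\<And>g. g \<in> carrier G \<Longrightarrow> \<rho> g * A = A * \<tau> g"
    and nz: "A \<noteq> 0\<^sub>m n m"
  obtains B where "B \<in> carrier_mat m n" "A * B = 1\<^sub>m n" "B * A = 1\<^sub>m m"
proof -
  have r\<rho>: "representation G n \<rho>" and r\<tau>: "representation G m \<tau>"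
    using \<rho> \<tau> by (auto simp: irreducible_representation_def)
  note c\<rho> = representationD(1)[OF r\<rho>] and c\<tau> = representationD(1)[OF r\<tau>]
  define K where "K = {v \<in> carrier_vec m. A *\<^sub>v v = 0\<^sub>v n}"
  define R where "R = {A *\<^sub>v v | v. v \<in> carrier_vec m}"
  \<comment> \<open>A matrix that kills all unit vectors has only zero columns. This excludes a full
    kernel and a zero range, and later shows that \<open>D\<close> vanishes.\<close>
  have col: "\<exists>v\<in>carrier_vec m. C *\<^sub>v v \<noteq> 0\<^sub>v k" if "C \<in> carrier_mat k m" "C \<noteq> 0\<^sub>m k m" for C :: "complex mat" and k
  proof (rule ccontr)
    assume "\<not> ?thesis"
    then have *: "C *\<^sub>v unit_vec m j = 0\<^sub>v k" for j by auto
    have "C $$ (i, j) = 0" if "i < k" "j < m" for i j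
      using arg_cong[OF *[of j], of "\<lambda>v. v $ i"] that \<open>C \<in> carrier_mat k m\<close> by simp
    with that show False by auto
  qed
  have subK: "VectorSpace.subspace class_ring K (module_vec TYPE(complex) m)"
    by (rule subspace_module_vecI)
       (use A in \<open>auto simp: K_def mult_add_distrib_mat_vec mult_mat_vec\<close>)
  have "\<tau> g *\<^sub>v v \<in> K" if "g \<in> carrier G" "v \<in> K" for g v
  proof -
    have v: "v \<in> carrier_vec m" "A *\<^sub>v v = 0\<^sub>v n" using that by (auto simp: K_def)
    have "A *\<^sub>v (\<tau> g *\<^sub>v v) = (A * \<tau> g) *\<^sub>v v"
      using assoc_mult_mat_vec[OF A c\<tau>] v that by simp
    also have "\<dots> = (\<rho> g * A) *\<^sub>v v" using comm that by simp
    also have "\<dots> = \<rho> g *\<^sub>v (A *\<^sub>v v)"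
      using assoc_mult_mat_vec[OF c\<rho> A] v that by simp
    also have "\<dots> = 0\<^sub>v n" using v c\<rho>[of g] that by auto
    finally show ?thesis using c\<tau>[of g] that v by (auto simp: K_def)
  qed
  then have "K = {0\<^sub>v m} \<or> K = carrier_vec m"
    using \<tau> subK by (auto simp: irreducible_representation_def)
  moreover have "K \<noteq> carrier_vec m" using col[OF A nz] by (auto simp: K_def)
  ultimately have K: "K = {0\<^sub>v m}" by simp
  have subR: "VectorSpace.subspace class_ring R (module_vec TYPE(complex) n)"
  proof (rule subspace_module_vecI)
    show "R \<subseteq> carrier_vec n" using A by (auto simp: R_def)
    show "0\<^sub>v n \<in> R"
      unfolding R_def using A by (intro CollectI exI[of _ "0\<^sub>v m"]) auto
    show "v + w \<in> R" if "v \<in> R" "w \<in> R" for v w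
      using that mult_add_distrib_mat_vec[OF A] unfolding R_def
      by clarsimp (metis add_carrier_vec)
    show "c \<cdot>\<^sub>v v \<in> R" if "v \<in> R" for c v
      using that mult_mat_vec[OF A] unfolding R_def
      by clarsimp (metis smult_carrier_vec)
  qed
  have "\<rho> g *\<^sub>v w \<in> R" if g: "g \<in> carrier G" and w: "w \<in> R" for g w
  proof -
    obtain v where v: "v \<in> carrier_vec m" "w = A *\<^sub>v v" using w by (auto simp: R_def)
    have "\<rho> g *\<^sub>v w = (\<rho> g * A) *\<^sub>v v"
      using assoc_mult_mat_vec[OF c\<rho>[OF g] A] v by simp
    also have "\<dots> = A *\<^sub>v (\<tau> g *\<^sub>v v)"
      using comm[OF g] assoc_mult_mat_vec[OF A c\<tau>[OF g]] v by simp
    finally have "\<rho> g *\<^sub>v w = A *\<^sub>v (\<tau> g *\<^sub>v v)" .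
    moreover have "\<tau> g *\<^sub>v v \<in> carrier_vec m" using c\<tau>[OF g] v by auto
    ultimately show ?thesis by (auto simp: R_def)
  qed
  then have "R = {0\<^sub>v n} \<or> R = carrier_vec n"
    using \<rho> subR by (auto simp: irreducible_representation_def)
  moreover have "R \<noteq> {0\<^sub>v n}" using col[OF A nz] by (auto simp: R_def)
  ultimately have R: "R = carrier_vec n" by simp
  have "\<exists>v. v \<in> carrier_vec m \<and> A *\<^sub>v v = unit_vec n j" for j
  proof -
    have "unit_vec n j \<in> R" by (simp add: R)
    then show ?thesis by (auto simp: R_def)
  qed
  then obtain b where b: "\<And>j. b j \<in> carrier_vec m" "\<And>j. A *\<^sub>v b j = unit_vec n j" by metis
  \<comment> \<open>Preimages under \<open>A\<close> of the unit vectors, taken as columns, form a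
    right inverse.\<close>
  define B where "B = mat_of_cols m (map b [0..<n])"
  have B: "B \<in> carrier_mat m n"
    using mat_of_cols_carrier(1)[of m "map b [0..<n]"] by (simp add: B_def)
  have colB: "col B j = b j" if "j < n" for j
    unfolding B_def using that b(1) by (subst col_mat_of_cols) auto
  have AB: "A * B = 1\<^sub>m n"
  proof (rule eq_matI)
    fix i j assume "i < dim_row (1\<^sub>m n :: complex mat)" "j < dim_col (1\<^sub>m n :: complex mat)"
    then have ij: "i < n" "j < n" by auto
    have "(A * B) $$ (i, j) = (A *\<^sub>v col B j) $ i" using A B ij by simp
    then show "(A * B) $$ (i, j) = 1\<^sub>m n $$ (i, j)"
      using ij b(2)[of j] by (simp add: colB)
  qed (use A B in auto)
  have "B * A = 1\<^sub>m m"
  proof -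
    \<comment> \<open>The right inverse is also a left inverse: \<open>A * D = 0\<close>, so every
      \<open>D *\<^sub>v v\<close> lies in the trivial kernel \<open>K\<close>.\<close>
    define D where "D = B * A - 1\<^sub>m m"
    have D: "D \<in> carrier_mat m m" unfolding D_def by (rule minus_carrier_mat) simp
    have "A * D = A * (B * A) - A * 1\<^sub>m m"
      unfolding D_def by (rule mult_minus_distrib_mat) (use A B in auto)
    also have "A * (B * A) = A * B * A" using A B by (simp add: assoc_mult_mat)
    finally have AD: "A * D = 0\<^sub>m n m" using A by (simp add: AB)
    have "D = 0\<^sub>m m m"
    proof (rule ccontr)
      assume "D \<noteq> 0\<^sub>m m m"
      then obtain v where v: "v \<in> carrier_vec m" "D *\<^sub>v v \<noteq> 0\<^sub>v m" using col[OF D] by auto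
      have "A *\<^sub>v (D *\<^sub>v v) = 0\<^sub>m n m *\<^sub>v v"
        using assoc_mult_mat_vec[OF A D v(1)] AD by simp
      then have "D *\<^sub>v v \<in> K" using v D by (auto simp: K_def)
      with v K show False by simp
    qed
    then have *: "D $$ (i, j) = 0" if "i < m" "j < m" for i j using that by simp
    show ?thesis
      by (rule eq_matI) (use * A B in \<open>auto simp: D_def\<close>)
  qed
  with B AB that show thesis by blast
qed

text \<open>Schur's lemma, second half. Over the complex numbers \<open>A\<close> has an eigenvalue
  \<open>c\<close>. The matrix \<open>A - c\<close> still commutes with \<open>\<rho>\<close> but
  kills an eigenvector, so it is not invertible and must be zero.\<close>

lemma schur_scalar:
  assumes \<rho>: "irreducible_representation G n \<rho>"
    and A: "A \<in> carrier_mat n n"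
    and comm: "\<And>g. g \<in> carrier G \<Longrightarrow> \<rho> g * A = A * \<rho> g"
  obtains c where "A = c \<cdot>\<^sub>m 1\<^sub>m n"
proof -
  have n: "n > 0" and r: "representation G n \<rho>"
    using \<rho> by (auto simp: irreducible_representation_def)
  obtain c v where v: "v \<in> carrier_vec n" "v \<noteq> 0\<^sub>v n" "A *\<^sub>v v = c \<cdot>\<^sub>v v"
    using spectrum_non_empty[OF A n] A
    by (auto simp: spectrum_def eigenvalue_def eigenvector_def)
  define D where "D = A - c \<cdot>\<^sub>m 1\<^sub>m n"
  have D: "D \<in> carrier_mat n n" unfolding D_def by (rule minus_carrier_mat) simp
  have "\<rho> g * D = D * \<rho> g" if g: "g \<in> carrier G" for g
  proof -
    have "\<rho> g \<in> carrier_mat n n" using representationD(1)[OF r g] .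
    then show ?thesis using A comm[OF g] unfolding D_def
      by (subst mult_minus_distrib_mat[where nc = n and n = n and nr = n])
         (auto simp: minus_mult_distrib_mat[where nr = n and n = n and nc = n]
           mult_smult_distrib[where nr = n and n = n and nc = n]
           mult_smult_assoc_mat[where nr = n and n = n and nc = n])
  qed
  moreover have "D *\<^sub>v v = 0\<^sub>v n"
  proof -
    have "c \<cdot>\<^sub>m 1\<^sub>m n *\<^sub>v v = c \<cdot>\<^sub>v v"
      by (rule eq_vecI) (use v in \<open>auto simp: row_smult\<close>)
    then show ?thesis
      using v A minus_mult_distrib_mat_vec[OF A _ v(1), of "c \<cdot>\<^sub>m 1\<^sub>m n"] by (simp add: D_def)
  qed
  ultimately have "D = 0\<^sub>m n n"
  proof -
    assume 1: "\<And>g. g \<in> carrier G \<Longrightarrow> \<rho> g * D = D * \<rho> g" and 2: "D *\<^sub>v v = 0\<^sub>v n"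
    show ?thesis
    proof (rule ccontr)
      assume "D \<noteq> 0\<^sub>m n n"
      then obtain B where B: "B \<in> carrier_mat n n" "B * D = 1\<^sub>m n"
        using intertwiner_invertible[OF \<rho> \<rho> D 1] by blast
      have "v = B *\<^sub>v (D *\<^sub>v v)"
        using assoc_mult_mat_vec[OF B(1) D v(1)] B v by simp
      with 2 B v show False by auto
    qed
  qed
  then have *: "D $$ (i, j) = 0" if "i < n" "j < n" for i j using that by simp
  have "A = c \<cdot>\<^sub>m 1\<^sub>m n"
    by (rule eq_matI) (use * A in \<open>auto simp: D_def\<close>)
  then show thesis by (rule that)
qed

section \<open>Orthogonality relations for irreducible characters\<close>

context group
begin

text \<open>\<open>A\<close> is the sum over \<open>g\<close> of
  \<open>\<rho>(g) E \<tau>(inv g)\<close>, where \<open>E\<close> is the matrix unit at position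
  \<open>(j, k)\<close>. Replacing \<open>g\<close> by \<open>h g\<close> carries
  \<open>\<rho>(h)\<close> on the left over to \<open>\<tau>(h)\<close> on the right.\<close>

lemma averaged_intertwiner:
  assumes \<rho>: "representation G n \<rho>" and \<tau>: "representation G m \<tau>"
    and j: "j < n" and k: "k < m" and h: "h \<in> carrier G"
  defines "A \<equiv> mat n m (\<lambda>(i, l). \<Sum>g\<in>carrier G. \<rho> g $$ (i, j) * \<tau> (inv g) $$ (k, l))"
  shows "\<rho> h * A = A * \<tau> h"
proof (rule eq_matI)
  note c\<rho> = representationD(1)[OF \<rho>] and c\<tau> = representationD(1)[OF \<tau>]
  have A: "A \<in> carrier_mat n m" by (simp add: A_def)
  show "dim_row (\<rho> h * A) = dim_row (A * \<tau> h)" "dim_col (\<rho> h * A) = dim_col (A * \<tau> h)"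
    using c\<rho>[OF h] c\<tau>[OF h] A by auto
  fix i l assume "i < dim_row (A * \<tau> h)" "l < dim_col (A * \<tau> h)"
  then have i: "i < n" and l: "l < m" using A c\<tau>[OF h] by auto
  have "(\<rho> h * A) $$ (i, l) =
      (\<Sum>p<n. \<rho> h $$ (i, p) * (\<Sum>g\<in>carrier G. \<rho> g $$ (p, j) * \<tau> (inv g) $$ (k, l)))"
    using index_mat_mult_sum[OF c\<rho>[OF h] A i l] l by (simp add: A_def)
  also have "\<dots> = (\<Sum>g\<in>carrier G. (\<Sum>p<n. \<rho> h $$ (i, p) * \<rho> g $$ (p, j)) * \<tau> (inv g) $$ (k, l))"
    by (simp add: sum_distrib_left sum_distrib_right mult.assoc)
       (rule sum.swap)
  also have "\<dots> = (\<Sum>g\<in>carrier G. \<rho> (h \<otimes> g) $$ (i, j) * \<tau> (inv g) $$ (k, l))"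
    by (intro sum.cong refl)
       (simp add: representationD(2)[OF \<rho> h] index_mat_mult_sum[OF c\<rho>[OF h] c\<rho> i j])
  \<comment> \<open>The new summation variable is \<open>h \<otimes> g\<close>, whose inverse times
    \<open>h\<close> is \<open>inv g\<close>.\<close>
  also have "\<dots> = (\<Sum>g\<in>carrier G. \<rho> g $$ (i, j) * \<tau> (inv g \<otimes> h) $$ (k, l))"
    by (rule sum.reindex_bij_witness[where i = "\<lambda>g. inv h \<otimes> g" and j = "\<lambda>g. h \<otimes> g"])
       (use h in \<open>auto simp: m_assoc[symmetric] inv_mult_group\<close>, simp add: m_assoc)
  also have "\<dots> = (\<Sum>g\<in>carrier G. \<rho> g $$ (i, j) * (\<Sum>q<m. \<tau> (inv g) $$ (k, q) * \<tau> h $$ (q, l)))"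
    by (intro sum.cong refl)
       (simp add: representationD(2)[OF \<tau> _ h] index_mat_mult_sum[OF c\<tau> c\<tau>[OF h] k l])
  also have "\<dots> = (\<Sum>q<m. (\<Sum>g\<in>carrier G. \<rho> g $$ (i, j) * \<tau> (inv g) $$ (k, q)) * \<tau> h $$ (q, l))"
    by (simp add: sum_distrib_left sum_distrib_right mult.assoc)
       (rule sum.swap)
  also have "\<dots> = (A * \<tau> h) $$ (i, l)"
    using index_mat_mult_sum[OF A c\<tau>[OF h] i l] i by (simp add: A_def)
  finally show "(\<rho> h * A) $$ (i, l) = (A * \<tau> h) $$ (i, l)" .
qed

text \<open>Expanding both traces reduces orthogonality of characters to single entries of averaged
  intertwiners.\<close>

lemma sum_character_prod:
  assumes \<rho>: "representation G n \<rho>" and \<tau>: "representation G m \<tau>"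
  shows "(\<Sum>g\<in>carrier G. character G \<rho> g * character G \<tau> (inv g)) =
    (\<Sum>i<n. \<Sum>k<m. \<Sum>g\<in>carrier G. \<rho> g $$ (i, i) * \<tau> (inv g) $$ (k, k))"
proof -
  have "(\<Sum>g\<in>carrier G. character G \<rho> g * character G \<tau> (inv g)) =
    (\<Sum>g\<in>carrier G. \<Sum>i<n. \<Sum>k<m. \<rho> g $$ (i, i) * \<tau> (inv g) $$ (k, k))"
    using representationD(1)[OF \<rho>] representationD(1)[OF \<tau>]
    by (intro sum.cong refl) (auto simp: character_def trace_def sum_product dest!: carrier_matD(1))
  then show ?thesis
    by (simp add: sum.swap[of _ "carrier G"])
qed

text \<open>The averaged intertwiner attached to \<open>(i, k)\<close> is a scalar \<open>c\<close>,
  and its trace determines \<open>c\<close>. Only the \<open>n\<close> pairs with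
  \<open>i = k\<close> contribute, each with \<open>|G| / n\<close>.\<close>

lemma character_orthogonal_self:
  assumes \<rho>: "irreducible_representation G n \<rho>"
  shows "(\<Sum>g\<in>carrier G. character G \<rho> g * character G \<rho> (inv g)) = of_nat (card (carrier G))"
proof -
  have n: "n > 0" and r: "representation G n \<rho>"
    using \<rho> by (auto simp: irreducible_representation_def)
  note c\<rho> = representationD(1)[OF r]
  have entry: "(\<Sum>g\<in>carrier G. \<rho> g $$ (i, i) * \<rho> (inv g) $$ (k, k)) =
      (if i = k then of_nat (card (carrier G)) / of_nat n else 0)"
    if i: "i < n" and k: "k < n" for i k
  proof -
    define A where "A = mat n n (\<lambda>(p, l). \<Sum>g\<in>carrier G. \<rho> g $$ (p, i) * \<rho> (inv g) $$ (k, l))"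
    have "A \<in> carrier_mat n n" by (simp add: A_def)
    moreover have "\<rho> h * A = A * \<rho> h" if "h \<in> carrier G" for h
      unfolding A_def by (rule averaged_intertwiner[OF r r i k that])
    ultimately obtain c where c: "A = c \<cdot>\<^sub>m 1\<^sub>m n" by (rule schur_scalar[OF \<rho>])
    \<comment> \<open>Compute the trace of \<open>A\<close> in two ways: the sum over
      \<open>p\<close> is the \<open>(k, i)\<close> entry of
      \<open>\<rho> (inv g \<otimes> g)\<close>, the identity matrix.\<close>
    have "of_nat n * c = (\<Sum>p<n. A $$ (p, p))" by (simp add: c)
    also have "\<dots> = (\<Sum>g\<in>carrier G. \<Sum>p<n. \<rho> (inv g) $$ (k, p) * \<rho> g $$ (p, i))"
      by (simp add: A_def mult.commute) (rule sum.swap)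
    also have "\<dots> = (\<Sum>g\<in>carrier G. \<rho> (inv g \<otimes> g) $$ (k, i))"
      by (intro sum.cong refl, subst representationD(2)[OF r])
         (simp_all add: index_mat_mult_sum[OF c\<rho> c\<rho> k i] del: index_mult_mat(1))
    also have "\<dots> = (if i = k then of_nat (card (carrier G)) else 0)"
      using i k by (simp add: representation_one[OF is_group r])
    finally have "c = (if i = k then of_nat (card (carrier G)) / of_nat n else 0)"
      using n by (auto simp: field_simps split: if_splits)
    moreover have "(\<Sum>g\<in>carrier G. \<rho> g $$ (i, i) * \<rho> (inv g) $$ (k, k)) = A $$ (i, k)"
      using i k by (simp add: A_def)
    ultimately show ?thesis using i k by (simp add: c)
  qed
  then show ?thesis
    using n by (simp add: sum_character_prod[OF r r])
qed

text \<open>A nonzero averaged intertwiner would be invertible and so conjugate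
  \<open>\<tau>\<close> into \<open>\<rho>\<close>, giving equal traces. Distinct characters
  therefore force all these matrices to vanish.\<close>

lemma character_orthogonal:
  assumes \<rho>: "irreducible_representation G n \<rho>" and \<tau>: "irreducible_representation G m \<tau>"
    and ne: "character G \<rho> \<noteq> character G \<tau>"
  shows "(\<Sum>g\<in>carrier G. character G \<rho> g * character G \<tau> (inv g)) = 0"
proof -
  have r: "representation G n \<rho>" "representation G m \<tau>"
    using \<rho> \<tau> by (auto simp: irreducible_representation_def)
  have "(\<Sum>g\<in>carrier G. \<rho> g $$ (i, i) * \<tau> (inv g) $$ (k, k)) = 0"
    if i: "i < n" and k: "k < m" for i k
  proof -
    define A where "A = mat n m (\<lambda>(p, l). \<Sum>g\<in>carrier G. \<rho> g $$ (p, i) * \<tau> (inv g) $$ (k, l))"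
    have A: "A \<in> carrier_mat n m" by (simp add: A_def)
    have comm: "\<rho> h * A = A * \<tau> h" if "h \<in> carrier G" for h
      unfolding A_def by (rule averaged_intertwiner[OF r i k that])
    have "A = 0\<^sub>m n m"
    proof (rule ccontr)
      assume "A \<noteq> 0\<^sub>m n m"
      then obtain B where B: "B \<in> carrier_mat m n" "A * B = 1\<^sub>m n" "B * A = 1\<^sub>m m"
        using intertwiner_invertible[OF \<rho> \<tau> A comm] by blast
      have "trace (\<rho> g) = trace (\<tau> g)" if g: "g \<in> carrier G" for g
      proof -
        have c: "\<rho> g \<in> carrier_mat n n" "\<tau> g \<in> carrier_mat m m"
          using representationD(1)[OF r(1) g] representationD(1)[OF r(2) g] by auto
        have "\<rho> g = \<rho> g * A * B" using assoc_mult_mat[OF c(1) A B(1)] B c by simp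
        also have "\<dots> = A * (\<tau> g * B)" using assoc_mult_mat[OF A c(2) B(1)] comm g by simp
        finally have "trace (\<rho> g) = trace (A * (\<tau> g * B))" by simp
        also have "\<dots> = trace (\<tau> g * B * A)"
          using A B c by (intro trace_mult_comm) auto
        also have "\<tau> g * B * A = \<tau> g" using assoc_mult_mat[OF c(2) B(1) A] B c by simp
        finally show ?thesis .
      qed
      then have "character G \<rho> = character G \<tau>" by (auto simp: character_def)
      with ne show False ..
    qed
    moreover have "(\<Sum>g\<in>carrier G. \<rho> g $$ (i, i) * \<tau> (inv g) $$ (k, k)) = A $$ (i, k)"
      using i k by (simp add: A_def)
    ultimately show ?thesis using i k by simp
  qed
  then show ?thesis by (simp add: sum_character_prod[OF r])
qed

section \<open>Degrees, finiteness of \<open>Irr\<close> and proportional characters\<close>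

lemma Irr_orthogonality:
  assumes "\<chi> \<in> Irr G" "\<psi> \<in> Irr G"
  shows "(\<Sum>g\<in>carrier G. \<chi> g * \<psi> (inv g)) = (if \<chi> = \<psi> then of_nat (card (carrier G)) else 0)"
proof -
  obtain \<rho> n \<tau> m where "irreducible_representation G n \<rho>" "\<chi> = character G \<rho>"
    and "irreducible_representation G m \<tau>" "\<psi> = character G \<tau>"
    using assms by (auto simp: Irr_def)
  then show ?thesis
    using character_orthogonal_self character_orthogonal by simp
qed

lemma Irr_degree:
  assumes "\<chi> \<in> Irr G"
  obtains n :: nat where "n > 0" "\<chi> \<one> = of_nat n"
proof -
  obtain \<rho> n where "irreducible_representation G n \<rho>" "\<chi> = character G \<rho>"
    using assms by (auto simp: Irr_def)
  then have "n > 0" "\<chi> \<one> = of_nat n"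
    by (auto simp: irreducible_representation_def character_def trace_def
        representation_one[OF is_group])
  with that show thesis by blast
qed

lemma Irr_eq_0: "\<chi> \<in> Irr G \<Longrightarrow> g \<notin> carrier G \<Longrightarrow> \<chi> g = 0"
  by (auto simp: Irr_def character_def)

text \<open>Orthogonality makes irreducible characters linearly independent among functions on a set
  of \<open>|G|\<close> points. The dimension bound is obtained from square matrices: given
  \<open>k > |G|\<close> characters, the tables of values at \<open>g\<close> and at
  \<open>inv g\<close> are padded with zeros to size \<open>k\<close>.\<close>

lemma finite_Irr:
  assumes fin: "finite (carrier G)"
  shows "finite (Irr G)"
proof -
  let ?N = "card (carrier G)"
  have N: "?N > 0" using fin one_closed by (auto simp: card_gt_0_iff)
  have "card S \<le> ?N" if S: "S \<subseteq> Irr G" "finite S" for S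
  proof (rule ccontr)
    define k where "k = card S"
    assume "\<not> card S \<le> ?N"
    then have k: "k > ?N" by (simp add: k_def)
    obtain f where f: "bij_betw f {..<k} S"
      using ex_bij_betw_nat_finite[OF S(2)] by (auto simp: k_def atLeast0LessThan)
    obtain e where e: "bij_betw e {..<?N} (carrier G)"
      using ex_bij_betw_nat_finite[OF fin] by (auto simp: atLeast0LessThan)
    define A where "A = mat k k (\<lambda>(i, j). if j < ?N then f i (e j) else 0)"
    define B where "B = mat k k (\<lambda>(j, i). if j < ?N then f i (inv (e j)) / of_nat ?N else 0)"
    have AB: "A \<in> carrier_mat k k" "B \<in> carrier_mat k k" by (auto simp: A_def B_def)
    \<comment> \<open>Orthogonality says \<open>A * B = 1\<close>, although row \<open>N\<close> of \<open>B\<close> vanishes.\<close>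
    have "A * B = 1\<^sub>m k"
    proof (rule eq_matI)
      fix i j assume "i < dim_row (1\<^sub>m k :: complex mat)" "j < dim_col (1\<^sub>m k :: complex mat)"
      then have ij: "i < k" "j < k" by auto
      then have fij: "f i \<in> Irr G" "f j \<in> Irr G" using f S by (auto simp: bij_betw_def)
      have "(A * B) $$ (i, j) =
          (\<Sum>p<k. if p < ?N then f i (e p) * f j (inv (e p)) / of_nat ?N else 0)"
        using index_mat_mult_sum[OF AB ij] ij by (simp add: A_def B_def if_distrib cong: if_cong)
      also have "\<dots> = (\<Sum>p<?N. f i (e p) * f j (inv (e p)) / of_nat ?N)"
        using k by (intro sum.mono_neutral_cong_right) auto
      also have "\<dots> = (\<Sum>g\<in>carrier G. f i g * f j (inv g) / of_nat ?N)"
        by (rule sum.reindex_bij_betw[OF e])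
      also have "\<dots> = (if f i = f j then 1 else 0)"
        using N by (simp add: sum_divide_distrib[symmetric] Irr_orthogonality[OF fij])
      also have "\<dots> = 1\<^sub>m k $$ (i, j)"
        using ij f by (auto simp: bij_betw_def inj_on_def)
      finally show "(A * B) $$ (i, j) = 1\<^sub>m k $$ (i, j)" .
    qed (use AB in auto)
    then have "B * A = 1\<^sub>m k" by (rule mat_mult_left_right_inverse[OF AB])
    then have "(B * A) $$ (?N, ?N) = 1" using k by simp
    moreover have "(B * A) $$ (?N, ?N) = 0"
      using index_mat_mult_sum[OF AB(2,1) k k] k by (simp add: B_def)
    ultimately show False by simp
  qed
  then have "finite (Irr G) \<and> card (Irr G) \<le> ?N" by (rule finite_if_finite_subsets_card_bdd)
  then show ?thesis by simp
qed

text \<open>Pairing both sides with \<open>\<chi> (inv g)\<close> gives \<open>c |G|\<close> on one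
  side and, were the characters distinct, zero on the other.\<close>

lemma Irr_proportional:
  assumes fin: "finite (carrier G)" and Irr: "\<chi> \<in> Irr G" "\<psi> \<in> Irr G"
    and eq: "\<And>g. g \<in> carrier G \<Longrightarrow> c * \<chi> g = d * \<psi> g" and c: "c \<noteq> 0"
  shows "\<chi> = \<psi>"
proof (rule ccontr)
  assume "\<chi> \<noteq> \<psi>"
  then have "0 = d * (\<Sum>g\<in>carrier G. \<psi> g * \<chi> (inv g))"
    by (simp add: Irr_orthogonality[OF Irr(2,1)])
  also have "\<dots> = c * (\<Sum>g\<in>carrier G. \<chi> g * \<chi> (inv g))"
    by (simp add: sum_distrib_left mult.assoc[symmetric] eq)
  also have "\<dots> = c * of_nat (card (carrier G))" by (simp add: Irr_orthogonality[OF Irr(1,1)])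
  finally show False using c fin one_closed by auto
qed

end

section \<open>Sums of induced linear characters\<close>

text \<open>Finite sums of induced linear characters, given inductively so that closure properties
  follow by rule induction instead of by handling indexed families. Both rules constrain values on
  the carrier only, which builds in equality of class functions on \<open>G\<close>.\<close>

inductive induced_sum :: "('a, 'm) monoid_scheme \<Rightarrow> ('a \<Rightarrow> complex) \<Rightarrow> bool"
  for G where
  zero: "(\<And>g. g \<in> carrier G \<Longrightarrow> f g = 0) \<Longrightarrow> induced_sum G f"
| add: "subgroup H G \<Longrightarrow> linear_character (G\<lparr>carrier := H\<rparr>) l \<Longrightarrow> induced_sum G f \<Longrightarrow>
    (\<And>g. g \<in> carrier G \<Longrightarrow> f' g = induced G H l g + f g) \<Longrightarrow> induced_sum G f'"

text \<open>Link to the indexed form used by \<open>quasi_monomial\<close>: each use of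
  \<open>add\<close> corresponds to one more index, stored at \<open>Suc t\<close> so that the
  earlier summands stay unchanged.\<close>

lemma induced_sum_iff:
  "induced_sum G f \<longleftrightarrow> (\<exists>(t::nat) H l.
     (\<forall>i\<in>{1..t}. subgroup (H i) G \<and> linear_character (G\<lparr>carrier := H i\<rparr>) (l i)) \<and>
     (\<forall>g\<in>carrier G. (\<Sum>i=1..t. induced G (H i) (l i) g) = f g))"
  (is "_ \<longleftrightarrow> (\<exists>t H l. ?P t H l f)")
proof
  show "\<exists>t H l. ?P t H l f" if "induced_sum G f"
    using that
  proof induction
    case (zero f)
    then show ?case by (intro exI[of _ 0]) simp
  next
    case (add H l f f')
    obtain t :: nat and Hs ls where IH: "?P t Hs ls f" using add.IH by blast
    have "(\<Sum>i=1..t. induced G ((Hs(Suc t := H)) i) ((ls(Suc t := l)) i) g) =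
        (\<Sum>i=1..t. induced G (Hs i) (ls i) g)" for g
      by (intro sum.cong refl) auto
    then show ?case
      using IH add.hyps
      by (intro exI[of _ "Suc t"] exI[of _ "Hs(Suc t := H)"] exI[of _ "ls(Suc t := l)"]) auto
  qed
next
  assume "\<exists>t H l. ?P t H l f"
  then obtain t :: nat and H l where "?P t H l f" by blast
  then show "induced_sum G f"
  proof (induction t arbitrary: f)
    case 0
    then show ?case by (auto intro: induced_sum.zero)
  next
    case (Suc t)
    have IH: "induced_sum G (\<lambda>g. \<Sum>i=1..t. induced G (H i) (l i) g)"
      using Suc.prems by (intro Suc.IH) auto
    show ?case
    proof (rule induced_sum.add[OF _ _ IH])
      show "subgroup (H (Suc t)) G" "linear_character (G\<lparr>carrier := H (Suc t)\<rparr>) (l (Suc t))"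
        using Suc.prems by auto
      show "f g = induced G (H (Suc t)) (l (Suc t)) g + (\<Sum>i=1..t. induced G (H i) (l i) g)"
        if "g \<in> carrier G" for g
      proof -
        have "f g = (\<Sum>i=1..Suc t. induced G (H i) (l i) g)" using Suc.prems that by simp
        then show ?thesis by simp
      qed
    qed
  qed
qed

lemma quasi_monomial_iff:
  "quasi_monomial G (\<X>, \<K>) \<longleftrightarrow>
     (\<forall>X\<in>\<X>. \<exists>d::nat. d > 0 \<and> induced_sum G (\<lambda>g. of_nat d * sigma G X g))"
  unfolding quasi_monomial_def induced_sum_iff by (simp, blast)

lemma induced_sum_cong:
  assumes "induced_sum G f" "\<And>g. g \<in> carrier G \<Longrightarrow> f g = f' g"
  shows "induced_sum G f'"
  using assms by (cases rule: induced_sum.cases) (auto intro: induced_sum.intros)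

lemma induced_sum_induced:
  assumes "subgroup H G" "linear_character (G\<lparr>carrier := H\<rparr>) l"
  shows "induced_sum G (induced G H l)"
  using assms by (auto intro: induced_sum.add[where f = "\<lambda>_. 0"] induced_sum.zero)

lemma induced_sum_plus:
  assumes "induced_sum G f" "induced_sum G f'"
  shows "induced_sum G (\<lambda>g. f g + f' g)"
  using assms(1)
proof induction
  case (zero f)
  then show ?case by (auto intro: induced_sum_cong[OF assms(2)])
next
  case (add H l f h)
  show ?case by (rule induced_sum.add[OF add.hyps(1,2) add.IH]) (simp add: add.hyps)
qed

text \<open>Repeating the whole family scales it by a natural number. Division is not a closure
  property, which is why denominators are cleared when restricting.\<close>

lemma induced_sum_times_nat:
  assumes "induced_sum G f"
  shows "induced_sum G (\<lambda>g. of_nat n * f g)"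
proof (induction n)
  case 0
  show ?case by (rule induced_sum.zero) simp
next
  case (Suc n)
  show ?case
    using induced_sum_plus[OF assms Suc.IH] by (simp add: distrib_right)
qed

section \<open>Linear characters and induction from product subgroups\<close>

lemma linear_character_iff:
  assumes "group G"
  shows "linear_character G \<chi> \<longleftrightarrow>
     (\<forall>g\<in>carrier G. \<chi> g \<noteq> 0) \<and>
     (\<forall>g\<in>carrier G. \<forall>h\<in>carrier G. \<chi> (g \<otimes>\<^bsub>G\<^esub> h) = \<chi> g * \<chi> h) \<and>
     (\<forall>g. g \<notin> carrier G \<longrightarrow> \<chi> g = 0)"
  (is "_ \<longleftrightarrow> ?N \<and> ?M \<and> ?Z")
proof
  interpret group G by (rule assms)
  assume "linear_character G \<chi>"
  then obtain \<rho> where r: "representation G 1 \<rho>" and \<chi>: "\<chi> = character G \<rho>"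
    by (auto simp: linear_character_def)
  note c = representationD(1)[OF r]
  have val: "\<chi> g = (if g \<in> carrier G then \<rho> g $$ (0, 0) else 0)" for g
    using c[of g] by (auto simp: \<chi> character_def trace_def)
  have mult: "\<chi> (g \<otimes>\<^bsub>G\<^esub> h) = \<chi> g * \<chi> h" if "g \<in> carrier G" "h \<in> carrier G" for g h
    using index_mat_mult_sum[OF c c, of g h 0 0] that
    by (simp add: val representationD(2)[OF r])
  have one: "\<chi> \<one>\<^bsub>G\<^esub> = 1"
    by (simp add: val representation_one[OF assms r])
  have "\<chi> g \<noteq> 0" if "g \<in> carrier G" for g
    using mult[of g "inv\<^bsub>G\<^esub> g"] one that by auto
  then show "?N \<and> ?M \<and> ?Z" using mult by (auto simp: val)
next
  assume *: "?N \<and> ?M \<and> ?Z"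
  define \<rho> where "\<rho> g = mat 1 1 (\<lambda>_. \<chi> g)" for g
  have eq1: "A = B" if "A \<in> carrier_mat 1 1" "B \<in> carrier_mat 1 1" "A $$ (0, 0) = B $$ (0, 0)"
    for A B :: "complex mat"
    by (rule eq_matI) (use that in auto)
  have mult: "mat 1 1 (\<lambda>_. a) * mat 1 1 (\<lambda>_. b) = mat 1 1 (\<lambda>_. a * b)" for a b :: complex
    by (rule eq1) (auto simp: scalar_prod_def)
  have one: "mat 1 1 (\<lambda>_. 1 :: complex) = 1\<^sub>m 1"
    by (rule eq1) auto
  have "\<rho> \<in> hom G (GL 1)"
  proof (rule homI)
    fix g assume g: "g \<in> carrier G"
    have "mat 1 1 (\<lambda>_. inverse (\<chi> g)) \<in> carrier_mat 1 1" by simp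
    moreover have "mat 1 1 (\<lambda>_. inverse (\<chi> g)) * \<rho> g = 1\<^sub>m 1"
      and "\<rho> g * mat 1 1 (\<lambda>_. inverse (\<chi> g)) = 1\<^sub>m 1"
      using * g by (simp_all add: \<rho>_def mult one del: One_nat_def)
    ultimately show "\<rho> g \<in> carrier (GL 1)"
      unfolding units_of_carrier Units_ring_mat_iff by (auto simp: \<rho>_def)
  next
    fix g h assume "g \<in> carrier G" "h \<in> carrier G"
    then show "\<rho> (g \<otimes>\<^bsub>G\<^esub> h) = \<rho> g \<otimes>\<^bsub>GL 1\<^esub> \<rho> h"
      using * by (simp add: \<rho>_def mult units_of_mult ring_mat_simps del: One_nat_def)
  qed
  moreover have "\<chi> = character G \<rho>"
    using * by (auto simp: character_def trace_def \<rho>_def)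
  ultimately show "linear_character G \<chi>"
    by (auto simp: linear_character_def representation_def)
qed

text \<open>Replaces 1 by 1 matrices by scalars: nonvanishing encodes invertibility, and the last
  clause is the convention of extension by zero, here off \<open>H\<close>.\<close>

lemma linear_character_subgroup_iff:
  assumes "group G" "subgroup H G"
  shows "linear_character (G\<lparr>carrier := H\<rparr>) \<chi> \<longleftrightarrow>
     (\<forall>g\<in>H. \<chi> g \<noteq> 0) \<and> (\<forall>g\<in>H. \<forall>h\<in>H. \<chi> (g \<otimes>\<^bsub>G\<^esub> h) = \<chi> g * \<chi> h) \<and>
     (\<forall>g. g \<notin> H \<longrightarrow> \<chi> g = 0)"
  using linear_character_iff[OF subgroup.subgroup_is_group[OF assms(2,1)]] by simp

lemma linear_character_char_prod:
  assumes "group G" "subgroup H G" "linear_character (G\<lparr>carrier := H\<rparr>) l"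
    and "group G'" "subgroup H' G'" "linear_character (G'\<lparr>carrier := H'\<rparr>) l'"
  shows "linear_character ((G \<times>\<times> G')\<lparr>carrier := H \<times> H'\<rparr>) (char_prod l l')"
  using assms(3,6)
  unfolding linear_character_subgroup_iff[OF assms(1,2)] linear_character_subgroup_iff[OF assms(4,5)]
    linear_character_subgroup_iff[OF DirProd_group[OF assms(1,4)] DirProd_subgroups[OF assms(1,2,4,5)]]
  by (auto simp: char_prod_def)

text \<open>Conjugation in the direct product is componentwise, so the index set of the induction
  formula is a cartesian product and the double sum factors.\<close>

lemma induced_char_prod:
  assumes "group G" "group G'" and g: "g \<in> carrier G" "g' \<in> carrier G'"
  shows "induced (G \<times>\<times> G') (H \<times> H') (char_prod l l') (g, g') = induced G H l g * induced G' H' l' g'"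
proof -
  have "{z \<in> carrier (G \<times>\<times> G'). inv\<^bsub>G \<times>\<times> G'\<^esub> z \<otimes>\<^bsub>G \<times>\<times> G'\<^esub> (g, g') \<otimes>\<^bsub>G \<times>\<times> G'\<^esub> z \<in> H \<times> H'} =
    {x \<in> carrier G. inv\<^bsub>G\<^esub> x \<otimes>\<^bsub>G\<^esub> g \<otimes>\<^bsub>G\<^esub> x \<in> H} \<times>
    {y \<in> carrier G'. inv\<^bsub>G'\<^esub> y \<otimes>\<^bsub>G'\<^esub> g' \<otimes>\<^bsub>G'\<^esub> y \<in> H'}"
    using assms by auto
  then have "induced (G \<times>\<times> G') (H \<times> H') (char_prod l l') (g, g') =
     (\<Sum>z \<in> {x \<in> carrier G. inv\<^bsub>G\<^esub> x \<otimes>\<^bsub>G\<^esub> g \<otimes>\<^bsub>G\<^esub> x \<in> H} \<times>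
            {y \<in> carrier G'. inv\<^bsub>G'\<^esub> y \<otimes>\<^bsub>G'\<^esub> g' \<otimes>\<^bsub>G'\<^esub> y \<in> H'}.
        l (inv\<^bsub>G\<^esub> fst z \<otimes>\<^bsub>G\<^esub> g \<otimes>\<^bsub>G\<^esub> fst z) * l' (inv\<^bsub>G'\<^esub> snd z \<otimes>\<^bsub>G'\<^esub> g' \<otimes>\<^bsub>G'\<^esub> snd z)) /
        of_nat (card H * card H')"
    unfolding induced_def card_cartesian_product
    by (intro arg_cong2[where f = "(/)"] sum.cong) (use assms in \<open>auto simp: char_prod_def\<close>)
  also have "\<dots> = induced G H l g * induced G' H' l' g'"
    by (simp add: induced_def sum_product sum.cartesian_product case_prod_beta)
  finally show ?thesis .
qed

text \<open>\<open>char_prod\<close> is additive in each argument. The outer induction splits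
  \<open>f\<close>; the inner one splits \<open>f'\<close> against a single induced
  character.\<close>

lemma induced_sum_char_prod:
  assumes G: "group G" and G': "group G'" and f: "induced_sum G f" and f': "induced_sum G' f'"
  shows "induced_sum (G \<times>\<times> G') (char_prod f f')"
  using f
proof induction
  case (zero f)
  then show ?case by (auto intro!: induced_sum.zero simp: char_prod_def)
next
  case (add H l f h)
  have "induced_sum (G \<times>\<times> G') (char_prod (induced G H l) f')"
    using f'
  proof induction
    case (zero f')
    then show ?case by (auto intro!: induced_sum.zero simp: char_prod_def)
  next
    case (add H' l' f' h')
    show ?case
      using DirProd_subgroups[OF G \<open>subgroup H G\<close> G' add.hyps(1)]
        linear_character_char_prod[OF G \<open>subgroup H G\<close> \<open>linear_character (G\<lparr>carrier := H\<rparr>) l\<close>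
          G' add.hyps(1,2)] add.IH
    proof (rule induced_sum.add)
      fix z assume "z \<in> carrier (G \<times>\<times> G')"
      then show "char_prod (induced G H l) h' z =
          induced (G \<times>\<times> G') (H \<times> H') (char_prod l l') z + char_prod (induced G H l) f' z"
        by (auto simp: char_prod_def[of "induced G H l"] induced_char_prod[OF G G'] add.hyps distrib_left)
    qed
  qed
  then show ?case
    by (rule induced_sum_cong[OF induced_sum_plus[OF _ add.IH]])
       (auto simp: char_prod_def distrib_right add.hyps)
qed

section \<open>Restriction of induced characters to a direct factor\<close>

text \<open>Mackey's formula for the restriction to a direct factor \<open>i ` G\<close> of \<open>P\<close>: the factor is normal
  and \<open>P\<close> acts on it by conjugation through the projection \<open>p\<close>, so only one subgroup \<open>K\<close> occurs.\<close>
lemma induced_restrict: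
  assumes G: "group G" "finite (carrier G)" and P: "group P" "finite (carrier P)"
    and i: "i \<in> hom G P" and p: "p \<in> carrier P \<rightarrow> carrier G"
    and conj: "\<And>x g. x \<in> carrier P \<Longrightarrow> g \<in> carrier G \<Longrightarrow>
      inv\<^bsub>P\<^esub> x \<otimes>\<^bsub>P\<^esub> i g \<otimes>\<^bsub>P\<^esub> x = i (inv\<^bsub>G\<^esub> p x \<otimes>\<^bsub>G\<^esub> g \<otimes>\<^bsub>G\<^esub> p x)"
    and fibre: "\<And>y. y \<in> carrier G \<Longrightarrow> card {x \<in> carrier P. p x = y} = c"
    and H: "subgroup H P" and l: "linear_character (P\<lparr>carrier := H\<rparr>) l"
  defines "K \<equiv> {k \<in> carrier G. i k \<in> H}"
  defines "l' \<equiv> \<lambda>k. if k \<in> K then l (i k) else 0"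
  shows "subgroup K G" "linear_character (G\<lparr>carrier := K\<rparr>) l'"
    and "g \<in> carrier G \<Longrightarrow> of_nat (card H) * induced P H l (i g) = of_nat (c * card K) * induced G K l' g"
proof -
  interpret G: group G by (rule G)
  interpret P: group P by (rule P)
  interpret i: group_hom G P i
    using i by unfold_locales
  interpret H: subgroup H P by (rule H)
  show K: "subgroup K G"
    by (rule G.subgroupI) (auto simp: K_def intro!: exI[of _ "\<one>\<^bsub>G\<^esub>"])
  show "linear_character (G\<lparr>carrier := K\<rparr>) l'"
    using l unfolding linear_character_subgroup_iff[OF G(1) K] linear_character_subgroup_iff[OF P(1) H]
    by (auto simp: l'_def K_def)
  have cardK: "card K \<noteq> 0"
    using subgroup.finite_imp_card_positive[OF K G(2)] by simp
  have cardH: "card H \<noteq> 0"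
    using H.finite_imp_card_positive[OF P(2)] by simp
  assume g: "g \<in> carrier G"
  define F where "F y = l' (inv\<^bsub>G\<^esub> y \<otimes>\<^bsub>G\<^esub> g \<otimes>\<^bsub>G\<^esub> y)" for y
  have closed: "inv\<^bsub>G\<^esub> p x \<otimes>\<^bsub>G\<^esub> g \<otimes>\<^bsub>G\<^esub> p x \<in> carrier G" if "x \<in> carrier P" for x
    using p g that by (auto simp: Pi_iff)
  have "of_nat (card H) * induced P H l (i g) =
      (\<Sum>x \<in> {x \<in> carrier P. inv\<^bsub>P\<^esub> x \<otimes>\<^bsub>P\<^esub> i g \<otimes>\<^bsub>P\<^esub> x \<in> H}. F (p x))"
    using cardH g closed by (auto simp: induced_def F_def l'_def K_def conj intro!: sum.cong)
  also have "\<dots> = (\<Sum>x\<in>carrier P. F (p x))"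
    by (intro sum.mono_neutral_left) (use P(2) g in \<open>auto simp: F_def l'_def K_def conj\<close>)
  \<comment> \<open>The summand depends on \<open>x\<close> only through \<open>p x\<close>, so it
    is constant on the fibres of \<open>p\<close>, each of size \<open>c\<close>.\<close>
  also have "\<dots> = (\<Sum>y\<in>carrier G. \<Sum>x\<in>{x \<in> carrier P. p x = y}. F (p x))"
    by (rule sum.group[symmetric]) (use P(2) G(2) p in auto)
  also have "\<dots> = of_nat c * (\<Sum>y\<in>carrier G. F y)"
    by (simp add: fibre sum_distrib_left)
  also have "(\<Sum>y\<in>carrier G. F y) =
      (\<Sum>y\<in>{y \<in> carrier G. inv\<^bsub>G\<^esub> y \<otimes>\<^bsub>G\<^esub> g \<otimes>\<^bsub>G\<^esub> y \<in> K}. F y)"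
    by (intro sum.mono_neutral_right) (use G(2) in \<open>auto simp: F_def l'_def\<close>)
  also have "\<dots> = of_nat (card K) * induced G K l' g"
    using cardK by (simp add: induced_def F_def)
  finally show "of_nat (card H) * induced P H l (i g) = of_nat (c * card K) * induced G K l' g"
    by simp
qed

text \<open>The order of \<open>P\<close> is a common multiple of the orders of all subgroups
  \<open>H\<close> that occur. Writing it as \<open>r * card H\<close>, each restricted summand
  becomes the natural multiple \<open>r * (c * card K)\<close> of a character induced from
  \<open>K\<close>.\<close>

lemma induced_sum_restrict:
  assumes G: "group G" "finite (carrier G)" and P: "group P" "finite (carrier P)"
    and i: "i \<in> hom G P" and p: "p \<in> carrier P \<rightarrow> carrier G"
    and conj: "\<And>x g. x \<in> carrier P \<Longrightarrow> g \<in> carrier G \<Longrightarrow>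
      inv\<^bsub>P\<^esub> x \<otimes>\<^bsub>P\<^esub> i g \<otimes>\<^bsub>P\<^esub> x = i (inv\<^bsub>G\<^esub> p x \<otimes>\<^bsub>G\<^esub> g \<otimes>\<^bsub>G\<^esub> p x)"
    and fibre: "\<And>y. y \<in> carrier G \<Longrightarrow> card {x \<in> carrier P. p x = y} = c"
    and f: "induced_sum P f"
  shows "induced_sum G (\<lambda>g. of_nat (Coset.order P) * f (i g))"
  using f
proof induction
  case (zero f)
  then show ?case using i by (intro induced_sum.zero) (auto simp: hom_def)
next
  case (add H l f h)
  define K where "K = {k \<in> carrier G. i k \<in> H}"
  define l' where "l' k = (if k \<in> K then l (i k) else 0)" for k
  define r where "r = card (rcosets\<^bsub>P\<^esub> H)"
  note restrict = induced_restrict[OF G P i p conj fibre add.hyps(1,2), folded K_def, folded l'_def]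
  have ord: "Coset.order P = r * card H"
    using group.lagrange[OF P(1) add.hyps(1)] by (simp add: r_def)
  have "induced_sum G (\<lambda>g. of_nat (r * (c * card K)) * induced G K l' g)"
    by (intro induced_sum_times_nat induced_sum_induced restrict)
  note induced_sum_plus[OF this add.IH]
  then show ?case
  proof (rule induced_sum_cong)
    fix g assume g: "g \<in> carrier G"
    then have "h (i g) = induced P H l (i g) + f (i g)" using i add.hyps(4) by (auto simp: hom_def)
    then show "of_nat (r * (c * card K)) * induced G K l' g + of_nat (Coset.order P) * f (i g) =
        of_nat (Coset.order P) * h (i g)"
      using restrict(3)[OF _ _ _ g] by (simp add: ord distrib_left mult.assoc)
  qed
qed

text \<open>Conjugating \<open>(g, 1)\<close> by \<open>(x, y)\<close> changes only the first
  coordinate, and does so through \<open>x\<close>; the fibres of \<open>fst\<close> are copies of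
  \<open>G'\<close>.\<close>

lemma induced_sum_restrict_fst:
  assumes G: "group G" "finite (carrier G)" and G': "group G'" "finite (carrier G')"
    and f: "induced_sum (G \<times>\<times> G') f"
  shows "induced_sum G (\<lambda>g. of_nat (Coset.order (G \<times>\<times> G')) * f (g, \<one>\<^bsub>G'\<^esub>))"
proof (rule induced_sum_restrict[where p = fst and c = "card (carrier G')"])
  interpret G': group G' by (rule G')
  show "(\<lambda>g. (g, \<one>\<^bsub>G'\<^esub>)) \<in> hom G (G \<times>\<times> G')" by (auto simp: hom_def)
  show "card {x \<in> carrier (G \<times>\<times> G'). fst x = y} = card (carrier G')" if "y \<in> carrier G" for y
  proof -
    have "{x \<in> carrier (G \<times>\<times> G'). fst x = y} = {y} \<times> carrier G'" using that by auto
    then show ?thesis by (simp add: card_cartesian_product)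
  qed
qed (use assms in \<open>auto simp: DirProd_group group.l_inv monoid.r_one group.is_monoid\<close>)

lemma induced_sum_restrict_snd:
  assumes G: "group G" "finite (carrier G)" and G': "group G'" "finite (carrier G')"
    and f: "induced_sum (G \<times>\<times> G') f"
  shows "induced_sum G' (\<lambda>g. of_nat (Coset.order (G \<times>\<times> G')) * f (\<one>\<^bsub>G\<^esub>, g))"
proof (rule induced_sum_restrict[where p = snd and c = "card (carrier G)"])
  interpret G: group G by (rule G)
  show "(\<lambda>g. (\<one>\<^bsub>G\<^esub>, g)) \<in> hom G' (G \<times>\<times> G')" by (auto simp: hom_def)
  show "card {x \<in> carrier (G \<times>\<times> G'). snd x = y} = card (carrier G)" if "y \<in> carrier G'" for y
  proof -
    have "{x \<in> carrier (G \<times>\<times> G'). snd x = y} = carrier G \<times> {y}" using that by auto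
    then show ?thesis by (simp add: card_cartesian_product)
  qed
qed (use assms in \<open>auto simp: DirProd_group group.l_inv monoid.r_one group.is_monoid\<close>)

section \<open>Supercharacters of a direct product\<close>

text \<open>Fixing one coordinate at the identity makes the characters of the other factor
  proportional, with a nonzero degree as coefficient, and proportional irreducible characters
  coincide.\<close>

lemma inj_on_char_prod:
  assumes G: "group G" "finite (carrier G)" and G': "group G'" "finite (carrier G')"
  shows "inj_on (\<lambda>(\<chi>, \<chi>'). char_prod \<chi> \<chi>') (Irr G \<times> Irr G')"
proof (rule inj_onI, clarify)
  fix \<chi> \<chi>' \<psi> \<psi>'
  assume Irr: "\<chi> \<in> Irr G" "\<chi>' \<in> Irr G'" "\<psi> \<in> Irr G" "\<psi>' \<in> Irr G'"
    and "char_prod \<chi> \<chi>' = char_prod \<psi> \<psi>'"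
  then have eq: "\<chi> g * \<chi>' g' = \<psi> g * \<psi>' g'" for g g'
    by (auto simp: char_prod_def dest!: fun_cong[of _ _ "(g, g')"])
  have nz: "\<chi> \<one>\<^bsub>G\<^esub> \<noteq> 0" "\<chi>' \<one>\<^bsub>G'\<^esub> \<noteq> 0"
    using group.Irr_degree[OF G(1) Irr(1)] group.Irr_degree[OF G'(1) Irr(2)]
    by (metis not_gr_zero of_nat_eq_0_iff)+
  have "\<chi> = \<psi>"
    by (rule group.Irr_proportional[OF G Irr(1,3) _ nz(2), of "\<psi>' \<one>\<^bsub>G'\<^esub>"])
       (use eq[of _ "\<one>\<^bsub>G'\<^esub>"] in \<open>simp add: mult.commute\<close>)
  moreover have "\<chi>' = \<psi>'"
    by (rule group.Irr_proportional[OF G' Irr(2,4) eq nz(1)])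
  ultimately show "\<chi> = \<psi> \<and> \<chi>' = \<psi>'" ..
qed

text \<open>The part is a set of functions, in which equal products would be counted once.
  Injectivity turns its sum into one over pairs, which factors since degrees multiply.\<close>

lemma sigma_char_prod:
  assumes G: "group G" "finite (carrier G)" and G': "group G'" "finite (carrier G')"
    and X: "X \<subseteq> Irr G" and X': "X' \<subseteq> Irr G'"
  shows "sigma (G \<times>\<times> G') {char_prod \<chi> \<chi>' | \<chi> \<chi>'. \<chi> \<in> X \<and> \<chi>' \<in> X'} =
    char_prod (sigma G X) (sigma G' X')"
proof -
  let ?XX = "{char_prod \<chi> \<chi>' | \<chi> \<chi>'. \<chi> \<in> X \<and> \<chi>' \<in> X'}"
  have inj: "inj_on (\<lambda>(\<chi>, \<chi>'). char_prod \<chi> \<chi>') (X \<times> X')"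
    using X X' by (intro inj_on_subset[OF inj_on_char_prod[OF G G']]) auto
  have XX: "?XX = (\<lambda>(\<chi>, \<chi>'). char_prod \<chi> \<chi>') ` (X \<times> X')" by auto
  have "sigma (G \<times>\<times> G') ?XX (g, g') = sigma G X g * sigma G' X' g'" for g g'
  proof -
    have "sigma (G \<times>\<times> G') ?XX (g, g') =
      (\<Sum>(\<chi>, \<chi>')\<in>X \<times> X'. (\<chi> \<one>\<^bsub>G\<^esub> * \<chi> g) * (\<chi>' \<one>\<^bsub>G'\<^esub> * \<chi>' g'))"
      unfolding XX sigma_def sum.reindex[OF inj]
      by (simp add: case_prod_beta char_prod_def mult_ac)
    also have "\<dots> = sigma G X g * sigma G' X' g'"
      by (simp add: sigma_def sum_product sum.cartesian_product)
    finally show ?thesis .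
  qed
  then show ?thesis by (auto simp: fun_eq_iff char_prod_def[of "sigma G X"])
qed

text \<open>The value is the sum of the squared degrees. Finiteness of \<open>X\<close> matters, as
  a sum over an infinite set is 0 by convention.\<close>

lemma sigma_one:
  assumes G: "group G" "finite (carrier G)" and X: "X \<subseteq> Irr G" "X \<noteq> {}"
  obtains n :: nat where "n > 0" "sigma G X \<one>\<^bsub>G\<^esub> = of_nat n"
proof -
  have fin: "finite X" using group.finite_Irr[OF G] X finite_subset by blast
  have "\<exists>n::nat. n > 0 \<and> \<chi> \<one>\<^bsub>G\<^esub> = of_nat n" if "\<chi> \<in> X" for \<chi>
    using group.Irr_degree[OF G(1)] X that by blast
  then obtain deg where deg: "\<And>\<chi>. \<chi> \<in> X \<Longrightarrow> deg \<chi> > (0::nat) \<and> \<chi> \<one>\<^bsub>G\<^esub> = of_nat (deg \<chi>)"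
    by metis
  show thesis
  proof (rule that)
    show "(\<Sum>\<chi>\<in>X. deg \<chi> * deg \<chi>) > 0" using fin X deg by (intro sum_pos) auto
    show "sigma G X \<one>\<^bsub>G\<^esub> = of_nat (\<Sum>\<chi>\<in>X. deg \<chi> * deg \<chi>)"
      using deg by (simp add: sigma_def)
  qed
qed

text \<open>\<open>\<X>\<close> is non-empty because it has as many members as the finite partition
  \<open>\<K>\<close>, which contains the class of the identity. This supplies a partner part when
  restricting from the product.\<close>

lemma supercharacter_theoryD:
  assumes "supercharacter_theory G (\<X>, \<K>)" "finite (carrier G)"
  shows "\<X> \<noteq> {}" and "X \<in> \<X> \<Longrightarrow> X \<subseteq> Irr G" and "X \<in> \<X> \<Longrightarrow> X \<noteq> {}"
proof -
  have \<X>: "partition_on (Irr G) \<X>" and \<K>: "partition_on (carrier G) \<K>" "\<K> \<noteq> {}"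
    and card: "card \<X> = card \<K>"
    using assms(1) by (auto simp: supercharacter_theory_def)
  have "finite \<K>" using finite_elements[OF assms(2) \<K>(1)] .
  with card \<K>(2) show "\<X> \<noteq> {}" by (metis card.empty card_0_eq)
  show "X \<in> \<X> \<Longrightarrow> X \<subseteq> Irr G" "X \<in> \<X> \<Longrightarrow> X \<noteq> {}"
    using \<X> by (auto simp: partition_on_def)
qed

theorem theorem2p8:
  fixes G :: "('a, 'm) monoid_scheme" and G' :: "('b, 'n) monoid_scheme"
    and C :: "'a char_theory" and C' :: "'b char_theory"
  assumes "group G" and "finite (carrier G)"
    and "group G'" and "finite (carrier G')"
    and "supercharacter_theory G C" and "supercharacter_theory G' C'"
  shows "quasi_monomial G C \<and> quasi_monomial G' C' \<longleftrightarrow>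
         quasi_monomial (G \<times>\<times> G') (prod_theory C C')"
proof -
  obtain \<X> \<K> \<X>' \<K>' where C: "C = (\<X>, \<K>)" and C': "C' = (\<X>', \<K>')" by fastforce
  note G = assms(1,2) and G' = assms(3,4)
  note D = supercharacter_theoryD[OF assms(5)[unfolded C] G(2)]
    and D' = supercharacter_theoryD[OF assms(6)[unfolded C'] G'(2)]
  have prod: "quasi_monomial (G \<times>\<times> G') (prod_theory C C') \<longleftrightarrow>
      (\<forall>X\<in>\<X>. \<forall>X'\<in>\<X>'. \<exists>d::nat. d > 0 \<and>
         induced_sum (G \<times>\<times> G') (\<lambda>z. of_nat d * char_prod (sigma G X) (sigma G' X') z))"
    (is "_ \<longleftrightarrow> (\<forall>X\<in>\<X>. \<forall>X'\<in>\<X>'. ?Q X X')")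
  proof -
    have "quasi_monomial (G \<times>\<times> G') (prod_theory C C') \<longleftrightarrow>
      (\<forall>X\<in>\<X>. \<forall>X'\<in>\<X>'. \<exists>d::nat. d > 0 \<and> induced_sum (G \<times>\<times> G')
         (\<lambda>z. of_nat d * sigma (G \<times>\<times> G') {char_prod \<chi> \<chi>' | \<chi> \<chi>'. \<chi> \<in> X \<and> \<chi>' \<in> X'} z))"
      unfolding C C' prod_theory_def prod.case quasi_monomial_iff by blast
    also have "\<dots> \<longleftrightarrow> (\<forall>X\<in>\<X>. \<forall>X'\<in>\<X>'. ?Q X X')"
      by (intro ball_cong refl) (simp add: sigma_char_prod[OF G G' D(2) D'(2)])
    finally show ?thesis .
  qed
  show ?thesis
  proof
    assume qm: "quasi_monomial G C \<and> quasi_monomial G' C'"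
    show "quasi_monomial (G \<times>\<times> G') (prod_theory C C')"
      unfolding prod
    proof (intro ballI)
      fix X X' assume X: "X \<in> \<X>" "X' \<in> \<X>'"
      obtain d d' :: nat where d: "d > 0" "induced_sum G (\<lambda>g. of_nat d * sigma G X g)"
        and d': "d' > 0" "induced_sum G' (\<lambda>g. of_nat d' * sigma G' X' g)"
        using qm X unfolding C C' quasi_monomial_iff by blast
      have "induced_sum (G \<times>\<times> G') (\<lambda>z. of_nat (d * d') * char_prod (sigma G X) (sigma G' X') z)"
        by (rule induced_sum_cong[OF induced_sum_char_prod[OF G(1) G'(1) d(2) d'(2)]])
           (auto simp: char_prod_def)
      with d(1) d'(1) show "?Q X X'" by (intro exI[of _ "d * d'"]) auto
    qed
  next
    assume qm: "quasi_monomial (G \<times>\<times> G') (prod_theory C C')"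
    have order: "Coset.order (G \<times>\<times> G') > 0"
      using DirProd_group[OF G(1) G'(1)] G(2) G'(2)
      by (simp add: group.is_monoid monoid.order_gt_0_iff_finite)
    \<comment> \<open>Any part of the other theory serves as partner; restriction turns its
      supercharacter into the constant given by its value at the identity.\<close>
    obtain X0 X0' where X0: "X0 \<in> \<X>" "X0' \<in> \<X>'" using D(1) D'(1) by blast
    have "quasi_monomial G C"
      unfolding C quasi_monomial_iff
    proof
      fix X assume X: "X \<in> \<X>"
      obtain d :: nat where d: "d > 0"
        "induced_sum (G \<times>\<times> G') (\<lambda>z. of_nat d * char_prod (sigma G X) (sigma G' X0') z)"
        using qm X X0 unfolding prod by blast
      obtain n :: nat where n: "n > 0" "sigma G' X0' \<one>\<^bsub>G'\<^esub> = of_nat n"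
        using sigma_one[OF G' D'(2,3)] X0 by blast
      \<comment> \<open>In the multiplier, the group order clears denominators, \<open>d\<close>
        comes from the identity on the product, and \<open>n\<close> is the value of the partner
        supercharacter at the identity. All three are positive.\<close>
      have "induced_sum G (\<lambda>g. of_nat (Coset.order (G \<times>\<times> G') * d * n) * sigma G X g)"
        by (rule induced_sum_cong[OF induced_sum_restrict_fst[OF G G' d(2)]])
           (simp add: char_prod_def n(2) mult_ac)
      with order d n show "\<exists>d::nat. d > 0 \<and> induced_sum G (\<lambda>g. of_nat d * sigma G X g)"
        by (intro exI[of _ "Coset.order (G \<times>\<times> G') * d * n"]) auto
    qed
    moreover have "quasi_monomial G' C'"
      unfolding C' quasi_monomial_iff
    proof
      fix X' assume X': "X' \<in> \<X>'"
      obtain d :: nat where d: "d > 0"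
        "induced_sum (G \<times>\<times> G') (\<lambda>z. of_nat d * char_prod (sigma G X0) (sigma G' X') z)"
        using qm X' X0 unfolding prod by blast
      obtain n :: nat where n: "n > 0" "sigma G X0 \<one>\<^bsub>G\<^esub> = of_nat n"
        using sigma_one[OF G D(2,3)] X0 by blast
      have "induced_sum G' (\<lambda>g. of_nat (Coset.order (G \<times>\<times> G') * d * n) * sigma G' X' g)"
        by (rule induced_sum_cong[OF induced_sum_restrict_snd[OF G G' d(2)]])
           (simp add: char_prod_def n(2) mult_ac)
      with order d n show "\<exists>d::nat. d > 0 \<and> induced_sum G' (\<lambda>g. of_nat d * sigma G' X' g)"
        by (intro exI[of _ "Coset.order (G \<times>\<times> G') * d * n"]) auto
    qed
    ultimately show "quasi_monomial G C \<and> quasi_monomial G' C'" ..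
  qed
qed

end
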